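(* Consider the adversarial convex body chasing game described in the context, with Lipschitz constants $L_c$, $L_\Theta$, $L_{v,t}$ as there. Let $\delta_{\mathcal X,0},\dots,\delta_{\mathcal X,T}\geq 0$ and let $\widehat{\mathcal X}_0,\dots,\widehat{\mathcal X}_T\subseteq\mathcal X$ be finite meshes satisfying the discretization conditions (D1)–(D3) of the context, with associated discretized value functions $\widehat V_t,\widehat U_t$. Then for all $t\in\{1,\dots,T\}$, all $i_{t-1}\in\mathcal V$ and all $\widehat{\mathbf x}_{t-1}\in\widehat{\mathcal X}_{t-1}\cap\mathcal Q_{t-1}^{(i_{t-1})}$, $$U_t(\widehat{\mathbf x}_{t-1},i_{t-1})\le\widehat U_t(\widehat{\mathbf x}_{t-1},i_{t-1})\le U_t(\widehat{\mathbf x}_{t-1},i_{t-1})+L_c\delta_{\mathcal X,T}+\sum_{\tau=t}^{T-1}(L_c+L_{v,\tau+1})\delta_{\mathcal X,\tau},$$ and for all $i_t\in\mathcal N_{i_{t-1}}$, $$V_t(\widehat{\mathbf x}_{t-1},i_t)\le\widehat V_t(\widehat{\mathbf x}_{t-1},i_t)\le V_t(\widehat{\mathbf x}_{t-1},i_t)+L_c\delta_{\mathcal X,T}+\sum_{\tau=t}^{T-1}(L_c+L_{v,\tau+1})\delta_{\mathcal X,\tau}.$$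
   Context: Setting. $\mathcal X$ is a compact subset of $\mathbb R^d$ equipped with a norm $\|\cdot\|$; $T\ge 1$ is an integer horizon. A set is solid if it has nonempty interior. A correspondence (set-valued map) $F:A\rightsquigarrow B$ assigns to each point of $A$ a subset of $B$. It is upper semi-continuous at $\mathbf x\in A$ if for every open $O\subseteq B$ with $F(\mathbf x)\subseteq O$ there is a neighborhood $N$ of $\mathbf x$ with $F(\mathbf x')\subseteq O$ for all $\mathbf x'\in N$; lower semi-continuous at $\mathbf x$ if for every open $O\subseteq B$ with $F(\mathbf x)\cap O\ne\emptyset$ there is a neighborhood $N$ of $\mathbf x$ with $F(\mathbf x')\cap O\neq\emptyset$ for all $\mathbf x'\in N$; continuous if it is both at every point. The Hausdorff distance is $\mathrm{dist}_{\mathrm H}(E,F)=\max\{\sup_{\mathbf x\in E}\inf_{\mathbf y\in F}\|\mathbf x-\mathbf y\|,\ \sup_{\mathbf y\in F}\inf_{\mathbf x\in E}\|\mathbf x-\mathbf y\|\}$. Data. $\mathcal G=(\mathcal V,\mathcal E)$ is a finite directed graph, $\mathcal N_i=\{j\in\mathcal V:(i,j)\in\mathcal E\}$, assumed nonempty for each $i\in\mathcal V$. $\mathcal Q=\{\mathcal Q_t^{(i)}\}_{t=0,\dots,T;\,i\in\mathcal V}$ is a collection of subsets of $\mathcal X$. $\mathcal R:\mathcal X\rightsquigarrow\mathcal X$ is the reachability correspondence, and $c:\mathcal X\times\mathcal X\to\mathbb R$ is a nonnegative cost function. Write $\Theta_t^{(j)}(\mathbf x)=\mathcal R(\mathbf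 x)\cap\mathcal Q_t^{(j)}$. Assumptions. (1) $\mathcal R(\mathbf x)$ is solid, compact and convex for all $\mathbf x\in\mathcal X$. (2) Each $\mathcal Q_t^{(i)}$ is solid, compact and convex. (3) For all $t\in\{1,\dots,T\}$, $i\in\mathcal V$, $j\in\mathcal N_i$ and $\mathbf x\in\mathcal Q_{t-1}^{(i)}$: $\mathrm{int}(\mathcal R(\mathbf x)\cap\mathcal Q_t^{(j)})\neq\emptyset$ (interior in $\mathbb R^d$). (4) $\mathcal R$ is continuous. (5) $|c(\mathbf x,\mathbf y)-c(\mathbf x',\mathbf y')|\le L_c(\|\mathbf x-\mathbf x'\|+\|\mathbf y-\mathbf y'\|)$ for all $(\mathbf x,\mathbf y),(\mathbf x',\mathbf y')\in\mathcal X\times\mathcal X$, with $L_c\ge0$. (6) $\mathrm{dist}_{\mathrm H}(\Theta_t^{(i)}(\mathbf x),\Theta_t^{(i)}(\mathbf x'))\le L_\Theta\|\mathbf x-\mathbf x'\|$ for all $t\in\{1,\dots,T\}$, $i,j\in\mathcal V$ with $i\in\mathcal N_j$, and $\mathbf x,\mathbf x'\in\mathcal Q_{t-1}^{(j)}$, with $L_\Theta\ge 0$. Set $L_{v,t}=L_c\sum_{k=1}^{T-t+1}(1+L_\Theta)^k$ for $t\in\{1,\dots,T\}$. Value functions. For $t\in\{1,\dots,T\}$, $V_t(\mathbf x,j)$ is defined for $\mathbf x\in\mathcal Q_{t-1}^{(i)}$ and $j\in\mathcal N_i$ (for some $i\in\mathcal V$), and $U_t(\mathbf x,i)$ for $i\in\mathcal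 V$, $\mathbf x\in\mathcal Q_{t-1}^{(i)}$, by backward recursion (the infima are attained under these assumptions, so $\inf$ may be read as $\min$): $$V_T(\mathbf x,j)=\inf_{\mathbf y\in\Theta_T^{(j)}(\mathbf x)}c(\mathbf x,\mathbf y),\qquad V_t(\mathbf x,j)=\inf_{\mathbf y\in\Theta_t^{(j)}(\mathbf x)}\Big\{c(\mathbf x,\mathbf y)+\max_{k\in\mathcal N_j}V_{t+1}(\mathbf y,k)\Big\}\ (1\le t\le T-1),$$ $$U_T(\mathbf x,i)=\max_{j\in\mathcal N_i}\ \inf_{\mathbf y\in\Theta_T^{(j)}(\mathbf x)}c(\mathbf x,\mathbf y),\qquad U_t(\mathbf x,i)=\max_{j\in\mathcal N_i}\ \inf_{\mathbf y\in\Theta_t^{(j)}(\mathbf x)}\{c(\mathbf x,\mathbf y)+U_{t+1}(\mathbf y,j)\}\ (1\le t\le T-1).$$ Discretization conditions (all sets over which minima are taken are in particular nonempty). (D1) $\min_{\widehat{\mathbf x}\in\widehat{\mathcal X}_t}\|\widehat{\mathbf x}-\mathbf x\|\le\delta_{\mathcal X,t}$ for all $\mathbf x\in\mathcal X$, $t\in\{0,\dots,T\}$. (D2) $\min_{\widehat{\mathbf x}\in\widehat{\mathcal X}_0\cap\mathcal Q_0^{(i)}}\|\widehat{\mathbf x}-\mathbf x\|\le\delta_{\mathcal X,0}$ for all $i\in\mathcal V$, $\mathbf x\in\mathcal Q_0^{(i)}$. (D3) For all $t\in\{1,\dots,T\}$, $j\in\mathcal V$, $i\in\mathcal N_j$,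 $\widehat{\mathbf x}_{t-1}\in\widehat{\mathcal X}_{t-1}\cap\mathcal Q_{t-1}^{(j)}$ and $\mathbf x\in\Theta_t^{(i)}(\widehat{\mathbf x}_{t-1})$: $\min_{\widehat{\mathbf x}\in\widehat{\mathcal X}_t\cap\Theta_t^{(i)}(\widehat{\mathbf x}_{t-1})}\|\widehat{\mathbf x}-\mathbf x\|\le\delta_{\mathcal X,t}$. Discretized value functions. For $\widehat{\mathbf x}\in\widehat{\mathcal X}_{t-1}\cap\mathcal Q_{t-1}^{(i)}$ and $j\in\mathcal N_i$: $$\widehat V_T(\widehat{\mathbf x},j)=\min_{\widehat{\mathbf y}\in\widehat{\mathcal X}_T\cap\Theta_T^{(j)}(\widehat{\mathbf x})}c(\widehat{\mathbf x},\widehat{\mathbf y}),\qquad \widehat V_t(\widehat{\mathbf x},j)=\min_{\widehat{\mathbf y}\in\widehat{\mathcal X}_t\cap\Theta_t^{(j)}(\widehat{\mathbf x})}\Big\{c(\widehat{\mathbf x},\widehat{\mathbf y})+\max_{k\in\mathcal N_j}\widehat V_{t+1}(\widehat{\mathbf y},k)\Big\}\ (1\le t\le T-1),$$ $$\widehat U_T(\widehat{\mathbf x},i)=\max_{j\in\mathcal N_i}\ \min_{\widehat{\mathbf y}\in\widehat{\mathcal X}_T\cap\Theta_T^{(j)}(\widehat{\mathbf x})}c(\widehat{\mathbf x},\widehat{\mathbf y}),\qquad \widehat U_t(\widehat{\mathbf x},i)=\max_{j\in\mathcal N_i}\ \min_{\widehat{\mathbf y}\in\widehat{\mathcal X}_t\cap\Theta_t^{(j)}(\widehat{\mathbf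 x})}\{c(\widehat{\mathbf x},\widehat{\mathbf y})+\widehat U_{t+1}(\widehat{\mathbf y},j)\}\ (1\le t\le T-1).$$ *)

theory Defs
  imports "HOL-Analysis.Analysis"
begin

text \<open>
  The norm on \<open>real ^ 'd\<close> is arbitrary, so it is a parameter \<open>nrm\<close> and need not be the built-in
  Euclidean one. All norms on a finite-dimensional space induce the same topology, hence
  \<^term>\<open>compact\<close>, \<^term>\<open>interior\<close> and \<^term>\<open>openin\<close> can be taken from the library.
\<close>

definition is_norm :: "('a::real_vector \<Rightarrow> real) \<Rightarrow> bool" where
  "is_norm nrm \<longleftrightarrow>
     (\<forall>x. 0 \<le> nrm x) \<and> (\<forall>x. nrm x = 0 \<longleftrightarrow> x = 0) \<and>
     (\<forall>a x. nrm (a *\<^sub>R x) = \<bar>a\<bar> * nrm x) \<and> (\<forall>x y. nrm (x + y) \<le> nrm x + nrm y)"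

definition solid :: "'a::topological_space set \<Rightarrow> bool" where
  "solid S \<longleftrightarrow> interior S \<noteq> {}"

text \<open>
  The suprema and infima are real-valued, so this is the Hausdorff distance only for nonempty
  bounded sets.
\<close>

definition dist_H :: "('a::real_vector \<Rightarrow> real) \<Rightarrow> 'a set \<Rightarrow> 'a set \<Rightarrow> real" where
  "dist_H nrm E F =
     max (SUP x\<in>E. INF y\<in>F. nrm (x - y)) (SUP y\<in>F. INF x\<in>E. nrm (x - y))"

text \<open>
  Correspondences from \<open>A\<close> to \<open>B\<close>; open sets and neighbourhoods are relative to \<open>B\<close> and \<open>A\<close>.
\<close>

definition correspondence :: "'a set \<Rightarrow> 'b set \<Rightarrow> ('a \<Rightarrow> 'b set) \<Rightarrow> bool" where
  "correspondence A B F \<longleftrightarrow> (\<forall>x\<in>A. F x \<subseteq> B)"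

definition upper_semicontinuous_at ::
  "'a::topological_space set \<Rightarrow> 'b::topological_space set \<Rightarrow> ('a \<Rightarrow> 'b set) \<Rightarrow> 'a \<Rightarrow> bool" where
  "upper_semicontinuous_at A B F x \<longleftrightarrow>
     (\<forall>W. openin (top_of_set B) W \<and> F x \<subseteq> W \<longrightarrow>
        (\<exists>N. openin (top_of_set A) N \<and> x \<in> N \<and> (\<forall>x'\<in>N. F x' \<subseteq> W)))"

definition lower_semicontinuous_at ::
  "'a::topological_space set \<Rightarrow> 'b::topological_space set \<Rightarrow> ('a \<Rightarrow> 'b set) \<Rightarrow> 'a \<Rightarrow> bool" where
  "lower_semicontinuous_at A B F x \<longleftrightarrow>
     (\<forall>W. openin (top_of_set B) W \<and> F x \<inter> W \<noteq> {} \<longrightarrow>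
        (\<exists>N. openin (top_of_set A) N \<and> x \<in> N \<and> (\<forall>x'\<in>N. F x' \<inter> W \<noteq> {})))"

definition continuous_correspondence ::
  "'a::topological_space set \<Rightarrow> 'b::topological_space set \<Rightarrow> ('a \<Rightarrow> 'b set) \<Rightarrow> bool" where
  "continuous_correspondence A B F \<longleftrightarrow>
     (\<forall>x\<in>A. upper_semicontinuous_at A B F x \<and> lower_semicontinuous_at A B F x)"

definition nbrs :: "'v set \<Rightarrow> ('v \<times> 'v) set \<Rightarrow> 'v \<Rightarrow> 'v set" where
  "nbrs V E i = {j \<in> V. (i, j) \<in> E}"

definition Theta :: "('a \<Rightarrow> 'a set) \<Rightarrow> (nat \<Rightarrow> 'v \<Rightarrow> 'a set) \<Rightarrow> nat \<Rightarrow> 'v \<Rightarrow> 'a \<Rightarrow> 'a set" where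
  "Theta R Q t j x = R x \<inter> Q t j"

definition Lv :: "nat \<Rightarrow> real \<Rightarrow> real \<Rightarrow> nat \<Rightarrow> real" where
  "Lv T Lc L\<Theta> t = Lc * (\<Sum>k = 1..T - t + 1. (1 + L\<Theta>) ^ k)"

text \<open>
  The value functions are total functions on \<open>nat\<close>, the whole space and all vertices; only the
  values for \<open>1 \<le> t \<le> T\<close> and points and vertices in the appropriate sets carry meaning. The
  argument \<open>Nb\<close> stands for \<^term>\<open>nbrs V E\<close>, and \<open>Th\<close> for \<^term>\<open>Theta R Q\<close>.
\<close>

function V_val :: "nat \<Rightarrow> ('v \<Rightarrow> 'v set) \<Rightarrow> ('a \<Rightarrow> 'a \<Rightarrow> real) \<Rightarrow> (nat \<Rightarrow> 'v \<Rightarrow> 'a \<Rightarrow> 'a set) \<Rightarrow>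
    nat \<Rightarrow> 'a \<Rightarrow> 'v \<Rightarrow> real" where
  "V_val T Nb c Th t x j =
     (if t < T
      then INF y\<in>Th t j x. c x y + (MAX k\<in>Nb j. V_val T Nb c Th (Suc t) y k)
      else INF y\<in>Th t j x. c x y)"
  by pat_completeness auto
termination
  by (relation "Wellfounded.measure (\<lambda>(T, Nb, c, Th, t, x, j). T - t)") auto

function U_val :: "nat \<Rightarrow> ('v \<Rightarrow> 'v set) \<Rightarrow> ('a \<Rightarrow> 'a \<Rightarrow> real) \<Rightarrow> (nat \<Rightarrow> 'v \<Rightarrow> 'a \<Rightarrow> 'a set) \<Rightarrow>
    nat \<Rightarrow> 'a \<Rightarrow> 'v \<Rightarrow> real" where
  "U_val T Nb c Th t x i =
     (if t < T
      then MAX j\<in>Nb i. INF y\<in>Th t j x. c x y + U_val T Nb c Th (Suc t) y j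
      else MAX j\<in>Nb i. INF y\<in>Th t j x. c x y)"
  by pat_completeness auto
termination
  by (relation "Wellfounded.measure (\<lambda>(T, Nb, c, Th, t, x, i). T - t)") auto

function Vhat :: "nat \<Rightarrow> ('v \<Rightarrow> 'v set) \<Rightarrow> ('a \<Rightarrow> 'a \<Rightarrow> real) \<Rightarrow> (nat \<Rightarrow> 'v \<Rightarrow> 'a \<Rightarrow> 'a set) \<Rightarrow>
    (nat \<Rightarrow> 'a set) \<Rightarrow> nat \<Rightarrow> 'a \<Rightarrow> 'v \<Rightarrow> real" where
  "Vhat T Nb c Th Xh t x j =
     (if t < T
      then MIN y\<in>Xh t \<inter> Th t j x. c x y + (MAX k\<in>Nb j. Vhat T Nb c Th Xh (Suc t) y k)
      else MIN y\<in>Xh t \<inter> Th t j x. c x y)"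
  by pat_completeness auto
termination
  by (relation "Wellfounded.measure (\<lambda>(T, Nb, c, Th, Xh, t, x, j). T - t)") auto

function Uhat :: "nat \<Rightarrow> ('v \<Rightarrow> 'v set) \<Rightarrow> ('a \<Rightarrow> 'a \<Rightarrow> real) \<Rightarrow> (nat \<Rightarrow> 'v \<Rightarrow> 'a \<Rightarrow> 'a set) \<Rightarrow>
    (nat \<Rightarrow> 'a set) \<Rightarrow> nat \<Rightarrow> 'a \<Rightarrow> 'v \<Rightarrow> real" where
  "Uhat T Nb c Th Xh t x i =
     (if t < T
      then MAX j\<in>Nb i. MIN y\<in>Xh t \<inter> Th t j x. c x y + Uhat T Nb c Th Xh (Suc t) y j
      else MAX j\<in>Nb i. MIN y\<in>Xh t \<inter> Th t j x. c x y)"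
  by pat_completeness auto
termination
  by (relation "Wellfounded.measure (\<lambda>(T, Nb, c, Th, Xh, t, x, i). T - t)") auto

text \<open>As unconditional rewrite rules the recursion equations would make the simplifier loop.\<close>

declare V_val.simps [simp del] U_val.simps [simp del] Vhat.simps [simp del] Uhat.simps [simp del]

text \<open>The minimum exists only for a nonempty (finite) set, so nonemptiness is part of the condition.\<close>

definition mesh_within :: "('a::real_vector \<Rightarrow> real) \<Rightarrow> 'a set \<Rightarrow> 'a \<Rightarrow> real \<Rightarrow> bool" where
  "mesh_within nrm S x \<delta> \<longleftrightarrow> S \<noteq> {} \<and> (MIN xh\<in>S. nrm (xh - x)) \<le> \<delta>"

end

(* Both value functions reduce to one tail cost: U is the maximum of V over the neighbours, and V at
   stage t minimises the current cost plus the tail cost of stage t (zero at t = T). Backward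
   induction on the stage first shows that the tail cost is Lipschitz, by moving a competitor between
   the sets Theta(x) and Theta(x') at Hausdorff cost, and then bounds the discretization error, by
   moving an optimal point to the mesh and charging the current stage cost and the Lipschitz
   constant of the tail. *)

theory Submission
  imports Defs
begin

section \<open>Comparison of infima and finite maxima up to an additive error\<close>

text \<open>The pattern of all value comparisons below: every competitor on the right is answered by
  one on the left that costs at most \<open>K\<close> more.\<close>

lemma cINF_le_cINF_add:
  fixes f g :: "'a \<Rightarrow> real"
  assumes "B \<noteq> {}" "bdd_below (f ` A)"
    and "\<And>y. y \<in> B \<Longrightarrow> \<exists>x\<in>A. f x \<le> g y + K"
  shows "(INF x\<in>A. f x) \<le> (INF y\<in>B. g y) + K"
proof -
  have "(INF x\<in>A. f x) - K \<le> g y" if y: "y \<in> B" for y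
  proof -
    obtain x where x: "x \<in> A" "f x \<le> g y + K" using assms(3)[OF y] by blast
    then show ?thesis using cINF_lower[OF assms(2) x(1)] by linarith
  qed
  then have "(INF x\<in>A. f x) - K \<le> (INF y\<in>B. g y)" by (intro cINF_greatest assms)
  then show ?thesis by simp
qed

lemma MAX_le_MAX_add:
  fixes f g :: "'a \<Rightarrow> real"
  assumes "finite A" "A \<noteq> {}" and "\<And>k. k \<in> A \<Longrightarrow> f k \<le> g k + K"
  shows "(MAX k\<in>A. f k) \<le> (MAX k\<in>A. g k) + K"
proof -
  have "f k \<le> (MAX k\<in>A. g k) + K" if "k \<in> A" for k
  proof -
    have "g k \<le> (MAX k\<in>A. g k)" using that assms(1) by (intro Max_ge) auto
    with assms(3)[OF that] show ?thesis by linarith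
  qed
  then show ?thesis using assms(1,2) by (subst Max_le_iff) auto
qed

section \<open>Norms, Hausdorff distance and mesh points\<close>

lemma is_norm_minus_commute:
  assumes "is_norm nrm"
  shows "nrm (x - y) = nrm (y - x)"
proof -
  have "nrm ((-1) *\<^sub>R (x - y)) = \<bar>-1\<bar> * nrm (x - y)"
    using assms unfolding is_norm_def by blast
  then show ?thesis by simp
qed

text \<open>Triangle inequality and homogeneity make the norm convex, and a convex function on a
  finite-dimensional space is continuous.\<close>

lemma is_norm_continuous_on:
  fixes nrm :: "'a::euclidean_space \<Rightarrow> real"
  assumes "is_norm nrm"
  shows "continuous_on S nrm"
proof -
  have "convex_on UNIV nrm"
  proof (rule convex_onI)
    fix t :: real and x y :: 'a
    assume t: "0 < t" "t < 1"
    have "nrm ((1 - t) *\<^sub>R x + t *\<^sub>R y) \<le> nrm ((1 - t) *\<^sub>R x) + nrm (t *\<^sub>R y)"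
      using assms unfolding is_norm_def by blast
    also have "\<dots> = (1 - t) * nrm x + t * nrm y"
      using assms t unfolding is_norm_def by simp
    finally show "nrm ((1 - t) *\<^sub>R x + t *\<^sub>R y) \<le> (1 - t) * nrm x + t * nrm y" .
  qed simp
  then have "continuous_on UNIV nrm" by (intro convex_on_continuous) auto
  then show ?thesis by (rule continuous_on_subset) simp
qed

text \<open>On a compact set the inner infimum is attained, so the distance yields an actual point.
  The rest ensures that the real-valued \<open>SUP\<close> in \<open>dist_H\<close> is a true upper
  bound.\<close>

lemma dist_H_near_point:
  fixes nrm :: "'a::euclidean_space \<Rightarrow> real"
  assumes norm: "is_norm nrm"
    and E: "compact E" and F: "compact F" "F \<noteq> {}" and x: "x \<in> E"
  obtains y where "y \<in> F" "nrm (y - x) \<le> dist_H nrm E F"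
proof -
  have cont: "continuous_on S (\<lambda>(x, y). nrm (x - y))" for S :: "('a \<times> 'a) set"
    unfolding case_prod_unfold
    by (rule continuous_on_compose2[OF is_norm_continuous_on[OF norm, of UNIV]])
      (auto intro!: continuous_intros)
  have "compact ((\<lambda>(x, y). nrm (x - y)) ` (E \<times> F))"
    by (intro compact_continuous_image cont compact_Times E F)
  \<comment> \<open>Compactness of \<open>E \<times> F\<close> gives one bound \<open>C\<close> for
    all distances, so the outer supremum ranges over a bounded set.\<close>
  then obtain C where C: "\<And>x y. x \<in> E \<Longrightarrow> y \<in> F \<Longrightarrow> nrm (x - y) \<le> C"
    by (force dest!: compact_imp_bounded bounded_imp_bdd_above simp: bdd_above_def)
  have bdd: "bdd_below ((\<lambda>y. nrm (z - y)) ` F)" for z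
    using norm by (intro bdd_belowI[of _ 0]) (auto simp: is_norm_def)
  have above: "bdd_above ((\<lambda>x. INF y\<in>F. nrm (x - y)) ` E)"
  proof (rule bdd_aboveI[of _ C], safe)
    fix z assume z: "z \<in> E"
    obtain y where y: "y \<in> F" using F(2) by blast
    show "(INF y\<in>F. nrm (z - y)) \<le> C"
      using cINF_lower[OF bdd y, of z] C[OF z y] by linarith
  qed
  have "continuous_on F (\<lambda>y. nrm (x - y))"
    by (rule continuous_on_compose2[OF is_norm_continuous_on[OF norm, of UNIV]])
      (auto intro!: continuous_intros)
  then obtain y where y: "y \<in> F" "\<And>z. z \<in> F \<Longrightarrow> nrm (x - y) \<le> nrm (x - z)"
    using continuous_attains_inf[OF F] by blast
  have "nrm (x - y) \<le> (INF y\<in>F. nrm (x - y))"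
    using y(2) by (intro cINF_greatest F)
  also have "\<dots> \<le> (SUP x\<in>E. INF y\<in>F. nrm (x - y))"
    by (rule cSUP_upper[OF x above])
  also have "\<dots> \<le> dist_H nrm E F" unfolding dist_H_def by simp
  finally show thesis using that[OF y(1)] is_norm_minus_commute[OF norm] by metis
qed

lemma mesh_withinD:
  assumes "mesh_within nrm S x d" "finite S"
  obtains xh where "xh \<in> S" "nrm (xh - x) \<le> d"
proof -
  have "(MIN xh\<in>S. nrm (xh - x)) \<in> (\<lambda>xh. nrm (xh - x)) ` S"
    using assms by (intro Min_in) (auto simp: mesh_within_def)
  then show thesis using assms(1) that by (auto simp: mesh_within_def)
qed

section \<open>Reduction of U to V\<close>

text \<open>Backward induction: the inner maximum in the recursion of \<open>V_val\<close> is
  \<open>U_val\<close> at the next stage. The base case covers all \<open>t \<ge> T\<close>, where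
  both recursions stop.\<close>

lemma U_val_eq_MAX_V_val:
  "U_val T Nb c Th t x i = (MAX j\<in>Nb i. V_val T Nb c Th t x j)"
proof (induction "T - t" arbitrary: t x i)
  case 0
  then show ?case by (simp add: U_val.simps[of T Nb c Th t x i] V_val.simps[of T Nb c Th t x])
next
  case (Suc n)
  then have "t < T" "n = T - Suc t" by auto
  with Suc.hyps(1)[of "Suc t"] show ?case
    by (simp add: U_val.simps[of T Nb c Th t x i] V_val.simps[of T Nb c Th t x])
qed

lemma Uhat_eq_MAX_Vhat:
  "Uhat T Nb c Th Xh t x i = (MAX j\<in>Nb i. Vhat T Nb c Th Xh t x j)"
proof (induction "T - t" arbitrary: t x i)
  case 0
  then show ?case by (simp add: Uhat.simps[of T Nb c Th Xh t x i] Vhat.simps[of T Nb c Th Xh t x])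
next
  case (Suc n)
  then have "t < T" "n = T - Suc t" by auto
  with Suc.hyps(1)[of "Suc t"] show ?case
    by (simp add: Uhat.simps[of T Nb c Th Xh t x i] Vhat.simps[of T Nb c Th Xh t x])
qed

section \<open>The exact game and the Lipschitz bound for its tail cost\<close>

text \<open>The assumptions take the form in which the induction uses them:
  \<open>Th_Lipschitz\<close> selects a near point in place of a Hausdorff bound, and the stages
  \<open>t\<close> and \<open>Suc t\<close> replace t - 1 and t, which avoids truncated
  subtraction.\<close>

locale chasing_game =
  fixes nrm :: "'a::real_vector \<Rightarrow> real" and X :: "'a set" and T :: nat
    and V :: "'v set" and Nb :: "'v \<Rightarrow> 'v set"
    and Q :: "nat \<Rightarrow> 'v \<Rightarrow> 'a set" and Th :: "nat \<Rightarrow> 'v \<Rightarrow> 'a \<Rightarrow> 'a set"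
    and c :: "'a \<Rightarrow> 'a \<Rightarrow> real" and Lc L\<Theta> :: real
  assumes norm: "is_norm nrm"
    and Nb: "i \<in> V \<Longrightarrow> finite (Nb i) \<and> Nb i \<noteq> {} \<and> Nb i \<subseteq> V"
    and Q_subset: "t \<le> T \<Longrightarrow> i \<in> V \<Longrightarrow> Q t i \<subseteq> X"
    and Th_subset: "Th t j x \<subseteq> Q t j"
    and Th_nonempty: "\<lbrakk>t < T; i \<in> V; j \<in> Nb i; x \<in> Q t i\<rbrakk> \<Longrightarrow> Th (Suc t) j x \<noteq> {}"
    and c_nonneg: "\<lbrakk>x \<in> X; y \<in> X\<rbrakk> \<Longrightarrow> 0 \<le> c x y"
    and c_Lipschitz: "\<lbrakk>x \<in> X; y \<in> X; x' \<in> X; y' \<in> X\<rbrakk> \<Longrightarrow>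
      \<bar>c x y - c x' y'\<bar> \<le> Lc * (nrm (x - x') + nrm (y - y'))"
    and Lc_nonneg: "0 \<le> Lc" and L\<Theta>_nonneg: "0 \<le> L\<Theta>"
    and Th_Lipschitz: "\<lbrakk>t < T; i \<in> V; j \<in> Nb i; x \<in> Q t i; x' \<in> Q t i; y' \<in> Th (Suc t) j x'\<rbrakk> \<Longrightarrow>
      \<exists>y\<in>Th (Suc t) j x. nrm (y - y') \<le> L\<Theta> * nrm (x - x')"
begin

abbreviation val :: "nat \<Rightarrow> 'a \<Rightarrow> 'v \<Rightarrow> real" where
  "val \<equiv> V_val T Nb c Th"

text \<open>For \<open>t < T\<close> this is \<open>U_val\<close> at stage \<open>Suc t\<close>. The
  value 0 at \<open>t = T\<close> merges both branches of the recursion into the single formula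
  \<open>val_eq\<close>.\<close>

definition tail :: "nat \<Rightarrow> 'a \<Rightarrow> 'v \<Rightarrow> real" where
  "tail t y j = (if t < T then MAX k\<in>Nb j. val (Suc t) y k else 0)"

text \<open>Agrees with \<^const>\<open>Lv\<close> at \<open>t + 1\<close> for \<open>t < T\<close>, but vanishes at \<open>t = T\<close>, where the truncated
  subtraction in \<^const>\<open>Lv\<close> does not.\<close>

definition tail_Lipschitz :: "nat \<Rightarrow> real" where
  "tail_Lipschitz t = Lc * (\<Sum>k = 1..T - t. (1 + L\<Theta>) ^ k)"

lemma tail_Lipschitz_eq_Lv: "t < T \<Longrightarrow> tail_Lipschitz t = Lv T Lc L\<Theta> (t + 1)"
  by (simp add: tail_Lipschitz_def Lv_def Suc_diff_Suc)

lemma tail_Lipschitz_nonneg: "0 \<le> tail_Lipschitz t"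
  unfolding tail_Lipschitz_def using Lc_nonneg L\<Theta>_nonneg
  by (intro mult_nonneg_nonneg sum_nonneg) auto

text \<open>The left side is the rate of change over one stage: moving \<open>x\<close> drags the
  competitor along by a factor \<open>L\<Theta>\<close>, which affects the stage cost in both
  arguments and the next tail once. The exact recursion has the factor \<open>1 + L\<Theta>\<close>
  on the next constant, which leaves slack.\<close>

lemma tail_Lipschitz_step:
  assumes "t < T"
  shows "Lc * (1 + L\<Theta>) + tail_Lipschitz (Suc t) * L\<Theta> \<le> tail_Lipschitz t"
proof -
  have eq: "T - t = Suc (T - Suc t)" using assms by simp
  \<comment> \<open>Split off \<open>k = 1\<close> and shift the remaining indices down by one, so
    that a factor \<open>1 + L\<Theta>\<close> comes out of the sum.\<close>
  have "tail_Lipschitz t = Lc * (1 + L\<Theta>) + (1 + L\<Theta>) * tail_Lipschitz (Suc t)"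
    unfolding tail_Lipschitz_def eq
    by (subst sum.atLeast_Suc_atMost)
      (simp_all add: sum.shift_bounds_cl_Suc_ivl sum_distrib_left algebra_simps del: sum.cl_ivl_Suc)
  then show ?thesis using tail_Lipschitz_nonneg[of "Suc t"] by (simp add: algebra_simps)
qed

lemma val_eq: "t \<le> T \<Longrightarrow> val t x j = (INF y\<in>Th t j x. c x y + tail t y j)"
  by (subst V_val.simps) (simp add: tail_def)

lemma nrm_nonneg: "0 \<le> nrm x"
  using norm by (simp add: is_norm_def)

lemma nrm_diff_self: "nrm (x - x) = 0"
  using norm by (simp add: is_norm_def)

text \<open>Nonnegative costs propagate backward. This supplies the lower bound in
  \<open>bdd_below_val\<close>, without which a real-valued \<open>INF\<close> need not lie below
  its elements.\<close>

lemma tail_nonneg: "\<lbrakk>t \<le> T; j \<in> V; y \<in> Q t j\<rbrakk> \<Longrightarrow> 0 \<le> tail t y j"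
proof (induction arbitrary: j y rule: inc_induct)
  case base
  show ?case by (simp add: tail_def)
next
  case (step t)
  have ge: "0 \<le> val (Suc t) y k" if k: "k \<in> Nb j" for k
  proof -
    have kV: "k \<in> V" using Nb step.prems k by blast
    have "0 \<le> c y z + tail (Suc t) z k" if "z \<in> Th (Suc t) k y" for z
    proof -
      have z: "z \<in> Q (Suc t) k" using that Th_subset by blast
      have "y \<in> X" "z \<in> X"
        using Q_subset[of t j] Q_subset[of "Suc t" k] step kV z by auto
      then show ?thesis using c_nonneg[of y z] step.IH[OF kV z] by simp
    qed
    then show ?thesis
      using step Th_nonempty[OF _ _ k] by (simp add: val_eq cINF_greatest)
  qed
  obtain k where "k \<in> Nb j" using Nb step.prems by blast
  then have "0 \<le> (MAX k\<in>Nb j. val (Suc t) y k)"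
    using ge Nb[OF step.prems(1)] by (auto simp: Max_ge_iff)
  then show ?case using step by (simp add: tail_def)
qed

lemma bdd_below_val:
  assumes "t < T" "i \<in> V" "j \<in> Nb i" "x \<in> Q t i"
  shows "bdd_below ((\<lambda>y. c x y + tail (Suc t) y j) ` Th (Suc t) j x)"
proof (rule bdd_belowI[of _ 0], safe)
  fix y assume "y \<in> Th (Suc t) j x"
  then have y: "y \<in> Q (Suc t) j" using Th_subset by blast
  have j: "j \<in> V" using Nb assms by blast
  have "x \<in> X" "y \<in> X"
    using Q_subset[of t i] Q_subset[of "Suc t" j] assms j y by auto
  then show "0 \<le> c x y + tail (Suc t) y j"
    using c_nonneg[of x y] tail_nonneg[OF _ j y] assms by simp
qed

text \<open>The one-sided form is enough, since \<open>x\<close> and \<open>x'\<close> may be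
  exchanged.\<close>

lemma tail_Lipschitz_le:
  "\<lbrakk>t \<le> T; i \<in> V; x \<in> Q t i; x' \<in> Q t i\<rbrakk> \<Longrightarrow>
     tail t x i \<le> tail t x' i + tail_Lipschitz t * nrm (x - x')"
proof (induction arbitrary: i x x' rule: inc_induct)
  case base
  show ?case using tail_Lipschitz_nonneg nrm_nonneg by (simp add: tail_def)
next
  case (step t)
  note t = \<open>t < T\<close> and i = step.prems(1) and x = step.prems(2) and x' = step.prems(3)
  let ?n = "nrm (x - x')"
  have "val (Suc t) x j \<le> val (Suc t) x' j + tail_Lipschitz t * ?n" if j: "j \<in> Nb i" for j
  proof -
    have jV: "j \<in> V" using Nb i j by blast
    have "\<exists>y\<in>Th (Suc t) j x. c x y + tail (Suc t) y j
        \<le> c x' y' + tail (Suc t) y' j + tail_Lipschitz t * ?n"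
      if y': "y' \<in> Th (Suc t) j x'" for y'
    proof -
      \<comment> \<open>The infimum at \<open>x\<close> is to be bounded from above, so a given
        competitor \<open>y'\<close> at \<open>x'\<close> is answered by a near one at
        \<open>x\<close>. Both lie in \<open>Q (Suc t) j\<close>, where the induction hypothesis
        applies.\<close>
      obtain y where y: "y \<in> Th (Suc t) j x" "nrm (y - y') \<le> L\<Theta> * ?n"
        using Th_Lipschitz[OF t i j x x' y'] by blast
      have Q: "y \<in> Q (Suc t) j" "y' \<in> Q (Suc t) j" using y y' Th_subset by blast+
      have "x \<in> X" "x' \<in> X" "y \<in> X" "y' \<in> X"
        using Q_subset[of t i] Q_subset[of "Suc t" j] t i jV x x' Q by auto
      then have "c x y \<le> c x' y' + Lc * (?n + nrm (y - y'))"
        using c_Lipschitz[of x y x' y'] by linarith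
      also have "\<dots> \<le> c x' y' + Lc * (?n + L\<Theta> * ?n)"
        using y(2) Lc_nonneg by (simp add: mult_left_mono)
      finally have c_le: "c x y \<le> c x' y' + Lc * (?n + L\<Theta> * ?n)" .
      have "tail (Suc t) y j \<le> tail (Suc t) y' j + tail_Lipschitz (Suc t) * nrm (y - y')"
        by (rule step.IH[OF jV Q])
      also have "\<dots> \<le> tail (Suc t) y' j + tail_Lipschitz (Suc t) * (L\<Theta> * ?n)"
        using y(2) tail_Lipschitz_nonneg by (simp add: mult_left_mono)
      finally have "c x y + tail (Suc t) y j \<le> c x' y' + tail (Suc t) y' j
          + (Lc * (1 + L\<Theta>) + tail_Lipschitz (Suc t) * L\<Theta>) * ?n"
        using c_le by (simp add: algebra_simps)
      also have "\<dots> \<le> c x' y' + tail (Suc t) y' j + tail_Lipschitz t * ?n"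
        using mult_right_mono[OF tail_Lipschitz_step[OF t] nrm_nonneg] by simp
      finally show ?thesis using y(1) by blast
    qed
    then show ?thesis
      using t by (simp add: val_eq cINF_le_cINF_add[OF Th_nonempty[OF t i j x'] bdd_below_val[OF t i j x]])
  qed
  \<comment> \<open>Both maxima run over the same neighbours, so the constant survives the
    maximum.\<close>
  then have "(MAX j\<in>Nb i. val (Suc t) x j) \<le> (MAX j\<in>Nb i. val (Suc t) x' j) + tail_Lipschitz t * ?n"
    using Nb[OF i] by (intro MAX_le_MAX_add) auto
  then show ?case using t by (simp add: tail_def)
qed

end

section \<open>The discretization error\<close>

locale discretized_chasing_game = chasing_game nrm X T V Nb Q Th c Lc L\<Theta>
  for nrm :: "'a::real_vector \<Rightarrow> real" and X :: "'a set" and T :: nat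
    and V :: "'v set" and Nb :: "'v \<Rightarrow> 'v set"
    and Q :: "nat \<Rightarrow> 'v \<Rightarrow> 'a set" and Th :: "nat \<Rightarrow> 'v \<Rightarrow> 'a \<Rightarrow> 'a set"
    and c :: "'a \<Rightarrow> 'a \<Rightarrow> real" and Lc L\<Theta> :: real +
  fixes \<delta> :: "nat \<Rightarrow> real" and Xh :: "nat \<Rightarrow> 'a set"
  assumes finite_Xh: "t \<le> T \<Longrightarrow> finite (Xh t)"
    and mesh: "\<lbrakk>t < T; i \<in> V; j \<in> Nb i; x \<in> Xh t \<inter> Q t i; y \<in> Th (Suc t) j x\<rbrakk> \<Longrightarrow>
      \<exists>yh\<in>Xh (Suc t) \<inter> Th (Suc t) j x. nrm (yh - y) \<le> \<delta> (Suc t)"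
begin

abbreviation valh :: "nat \<Rightarrow> 'a \<Rightarrow> 'v \<Rightarrow> real" where
  "valh \<equiv> Vhat T Nb c Th Xh"

definition tailh :: "nat \<Rightarrow> 'a \<Rightarrow> 'v \<Rightarrow> real" where
  "tailh t y j = (if t < T then MAX k\<in>Nb j. valh (Suc t) y k else 0)"

text \<open>The error bound of the theorem as one uniform sum: \<open>tail_Lipschitz T\<close> is 0,
  so the last summand is \<open>Lc * \<delta> T\<close>, and \<open>gap (Suc T)\<close> is the empty
  sum that starts the induction.\<close>

definition gap :: "nat \<Rightarrow> real" where
  "gap t = (\<Sum>\<tau>\<in>{t..T}. (Lc + tail_Lipschitz \<tau>) * \<delta> \<tau>)"

lemma gap_eq_Lv:
  assumes "t \<le> T"
  shows "gap t = Lc * \<delta> T + (\<Sum>\<tau>\<in>{t..<T}. (Lc + Lv T Lc L\<Theta> (\<tau> + 1)) * \<delta> \<tau>)"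
proof -
  have "gap t = (\<Sum>\<tau>\<in>{t..<T}. (Lc + tail_Lipschitz \<tau>) * \<delta> \<tau>) + (Lc + tail_Lipschitz T) * \<delta> T"
    unfolding gap_def using assms by (simp add: sum.last_plus add.commute)
  moreover have "tail_Lipschitz T = 0" by (simp add: tail_Lipschitz_def)
  ultimately show ?thesis by (simp add: tail_Lipschitz_eq_Lv)
qed

lemma mesh_Th_nonempty:
  "\<lbrakk>t < T; i \<in> V; j \<in> Nb i; x \<in> Xh t \<inter> Q t i\<rbrakk> \<Longrightarrow> Xh (Suc t) \<inter> Th (Suc t) j x \<noteq> {}"
  using mesh Th_nonempty by (metis IntD2 empty_iff ex_in_conv)

text \<open>Writing the minimum as an infimum lets \<open>cINF_le_cINF_add\<close> compare it with
  the exact value; the two agree because the set is finite and nonempty.\<close>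

lemma valh_eq:
  assumes "t < T" "i \<in> V" "j \<in> Nb i" "x \<in> Xh t \<inter> Q t i"
  shows "valh (Suc t) x j = (INF y\<in>Xh (Suc t) \<inter> Th (Suc t) j x. c x y + tailh (Suc t) y j)"
proof -
  have "valh (Suc t) x j = (MIN y\<in>Xh (Suc t) \<inter> Th (Suc t) j x. c x y + tailh (Suc t) y j)"
    by (subst Vhat.simps) (simp add: tailh_def)
  also have "\<dots> = (INF y\<in>Xh (Suc t) \<inter> Th (Suc t) j x. c x y + tailh (Suc t) y j)"
    using finite_Xh mesh_Th_nonempty[OF assms] assms(1) by (intro cInf_eq_Min[symmetric]) auto
  finally show ?thesis .
qed

text \<open>The hypothesis on the tails is the induction hypothesis in isolated form, so the step
  serves both within \<open>tailh_bounds\<close> and after it in \<open>valh_bounds\<close>. Stage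
  \<open>Suc t\<close> adds its own summand to the error of the tail.\<close>

lemma valh_bounds_step:
  assumes t: "t < T" and i: "i \<in> V" and j: "j \<in> Nb i" and x: "x \<in> Xh t \<inter> Q t i"
    and tail: "\<And>y. y \<in> Xh (Suc t) \<inter> Q (Suc t) j \<Longrightarrow> tail (Suc t) y j \<le> tailh (Suc t) y j \<and>
      tailh (Suc t) y j \<le> tail (Suc t) y j + gap (Suc (Suc t))"
  shows "val (Suc t) x j \<le> valh (Suc t) x j \<and> valh (Suc t) x j \<le> val (Suc t) x j + gap (Suc t)"
proof
  let ?A = "Th (Suc t) j x" and ?B = "Xh (Suc t) \<inter> Th (Suc t) j x"
  let ?f = "\<lambda>y. c x y + tail (Suc t) y j" and ?g = "\<lambda>y. c x y + tailh (Suc t) y j"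
  have xQ: "x \<in> Q t i" using x by simp
  \<comment> \<open>A mesh competitor is itself admissible in the exact problem, so it answers
    itself with error 0.\<close>
  have "\<exists>z\<in>?A. ?f z \<le> ?g y + 0" if "y \<in> ?B" for y
    using that tail[of y] Th_subset by (intro bexI[of _ y]) auto
  from cINF_le_cINF_add[OF mesh_Th_nonempty[OF t i j x] bdd_below_val[OF t i j xQ] this]
  show "val (Suc t) x j \<le> valh (Suc t) x j"
    using t by (simp add: val_eq valh_eq[OF t i j x])
  \<comment> \<open>Every exact competitor \<open>y\<close>, rather than a chosen minimiser, is
    rounded to a mesh point of the same set \<open>Th (Suc t) j x\<close>.\<close>
  have "\<exists>z\<in>?B. ?g z \<le> ?f y + gap (Suc t)" if y: "y \<in> ?A" for y
  proof -
    obtain z where z: "z \<in> ?B" "nrm (z - y) \<le> \<delta> (Suc t)"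
      using mesh[OF t i j x y] by blast
    have jV: "j \<in> V" using Nb i j by blast
    have Q: "y \<in> Q (Suc t) j" "z \<in> Q (Suc t) j" using y z Th_subset by blast+
    have "x \<in> X" "y \<in> X" "z \<in> X"
      using Q_subset[of t i] Q_subset[of "Suc t" j] t i jV xQ Q by auto
    then have "c x z \<le> c x y + Lc * nrm (z - y)"
      using c_Lipschitz[of x z x y] nrm_diff_self[of x] by simp
    \<comment> \<open>The move from \<open>y\<close> to \<open>z\<close> is charged to the exact
      tail; the discretized tail is compared with it only at the mesh point
      \<open>z\<close>.\<close>
    moreover have "tail (Suc t) z j \<le> tail (Suc t) y j + tail_Lipschitz (Suc t) * nrm (z - y)"
      using tail_Lipschitz_le[OF _ jV Q(2,1)] t by simp
    moreover have "tailh (Suc t) z j \<le> tail (Suc t) z j + gap (Suc (Suc t))"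
      using tail[of z] z(1) Q(2) by blast
    moreover have "(Lc + tail_Lipschitz (Suc t)) * nrm (z - y)
        \<le> (Lc + tail_Lipschitz (Suc t)) * \<delta> (Suc t)"
      using z(2) Lc_nonneg tail_Lipschitz_nonneg by (intro mult_left_mono) auto
    moreover have "gap (Suc t) = (Lc + tail_Lipschitz (Suc t)) * \<delta> (Suc t) + gap (Suc (Suc t))"
      using t by (simp add: gap_def sum.atLeast_Suc_atMost)
    ultimately have "?g z \<le> ?f y + gap (Suc t)" by (simp add: algebra_simps)
    then show ?thesis using z(1) by blast
  qed
  moreover have "bdd_below (?g ` ?B)" using finite_Xh t by (intro bdd_below_finite) auto
  ultimately show "valh (Suc t) x j \<le> val (Suc t) x j + gap (Suc t)"
    using cINF_le_cINF_add[OF Th_nonempty[OF t i j xQ], of ?g ?B ?f] t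
    by (simp add: val_eq valh_eq[OF t i j x])
qed

lemma MAX_valh_bounds:
  assumes "i \<in> V"
    and "\<And>j. j \<in> Nb i \<Longrightarrow> val t x j \<le> valh t x j \<and> valh t x j \<le> val t x j + K"
  shows "(MAX j\<in>Nb i. val t x j) \<le> (MAX j\<in>Nb i. valh t x j) \<and>
    (MAX j\<in>Nb i. valh t x j) \<le> (MAX j\<in>Nb i. val t x j) + K"
  using MAX_le_MAX_add[of "Nb i" "val t x" "valh t x" 0]
    MAX_le_MAX_add[of "Nb i" "valh t x" "val t x" K] Nb[OF assms(1)] assms(2) by simp

lemma tailh_bounds:
  "\<lbrakk>t \<le> T; i \<in> V; x \<in> Xh t \<inter> Q t i\<rbrakk> \<Longrightarrow>
     tail t x i \<le> tailh t x i \<and> tailh t x i \<le> tail t x i + gap (Suc t)"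
proof (induction arbitrary: i x rule: inc_induct)
  case base
  show ?case by (simp add: tail_def tailh_def gap_def)
next
  case (step t)
  have "val (Suc t) x j \<le> valh (Suc t) x j \<and> valh (Suc t) x j \<le> val (Suc t) x j + gap (Suc t)"
    if "j \<in> Nb i" for j
    by (rule valh_bounds_step[OF step.hyps(2) step.prems(1) that step.prems(2)])
      (use step Nb that in blast)
  from MAX_valh_bounds[OF step.prems(1) this] show ?case
    using step.hyps by (simp add: tail_def tailh_def)
qed

theorem valh_bounds:
  assumes "t < T" "i \<in> V" "j \<in> Nb i" "x \<in> Xh t \<inter> Q t i"
  shows "val (Suc t) x j \<le> valh (Suc t) x j \<and> valh (Suc t) x j \<le> val (Suc t) x j + gap (Suc t)"
  by (rule valh_bounds_step[OF assms]) (use tailh_bounds assms Nb in \<open>blast intro: Suc_leI\<close>)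

theorem Uhat_bounds:
  assumes "t < T" "i \<in> V" "x \<in> Xh t \<inter> Q t i"
  shows "U_val T Nb c Th (Suc t) x i \<le> Uhat T Nb c Th Xh (Suc t) x i \<and>
    Uhat T Nb c Th Xh (Suc t) x i \<le> U_val T Nb c Th (Suc t) x i + gap (Suc t)"
  unfolding U_val_eq_MAX_V_val Uhat_eq_MAX_Vhat
  by (rule MAX_valh_bounds) (use valh_bounds assms in blast)+

end

section \<open>From the assumptions on the game to the error bounds\<close>

theorem theorem3:
  fixes nrm :: "real ^ 'd \<Rightarrow> real"
    and X :: "(real ^ 'd) set"
    and T :: nat
    and V :: "'v set" and E :: "('v \<times> 'v) set"
    and Q :: "nat \<Rightarrow> 'v \<Rightarrow> (real ^ 'd) set"
    and R :: "real ^ 'd \<Rightarrow> (real ^ 'd) set"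
    and c :: "real ^ 'd \<Rightarrow> real ^ 'd \<Rightarrow> real"
    and Lc L\<Theta> :: real
    and \<delta> :: "nat \<Rightarrow> real"
    and Xh :: "nat \<Rightarrow> (real ^ 'd) set"
  assumes norm: "is_norm nrm"
    and X_compact: "compact X"
    and horizon: "1 \<le> T"
    and finite_V: "finite V" and edges: "E \<subseteq> V \<times> V"
    and nbrs_nonempty: "\<forall>i\<in>V. nbrs V E i \<noteq> {}"
    and Q_subset: "\<forall>t\<in>{0..T}. \<forall>i\<in>V. Q t i \<subseteq> X"
    and R_corr: "correspondence X X R"
    and c_nonneg: "\<forall>x\<in>X. \<forall>y\<in>X. 0 \<le> c x y"
    and A1: "\<forall>x\<in>X. solid (R x) \<and> compact (R x) \<and> convex (R x)"
    and A2: "\<forall>t\<in>{0..T}. \<forall>i\<in>V. solid (Q t i) \<and> compact (Q t i) \<and> convex (Q t i)"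
    and A3: "\<forall>t\<in>{1..T}. \<forall>i\<in>V. \<forall>j\<in>nbrs V E i. \<forall>x\<in>Q (t - 1) i. interior (R x \<inter> Q t j) \<noteq> {}"
    and A4: "continuous_correspondence X X R"
    and Lc_nonneg: "0 \<le> Lc"
    and A5: "\<forall>x\<in>X. \<forall>y\<in>X. \<forall>x'\<in>X. \<forall>y'\<in>X.
               \<bar>c x y - c x' y'\<bar> \<le> Lc * (nrm (x - x') + nrm (y - y'))"
    and L\<Theta>_nonneg: "0 \<le> L\<Theta>"
    and A6: "\<forall>t\<in>{1..T}. \<forall>j\<in>V. \<forall>i\<in>nbrs V E j. \<forall>x\<in>Q (t - 1) j. \<forall>x'\<in>Q (t - 1) j.
               dist_H nrm (Theta R Q t i x) (Theta R Q t i x') \<le> L\<Theta> * nrm (x - x')"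
    and \<delta>_nonneg: "\<forall>t\<in>{0..T}. 0 \<le> \<delta> t"
    and mesh: "\<forall>t\<in>{0..T}. finite (Xh t) \<and> Xh t \<subseteq> X"
    and D1: "\<forall>t\<in>{0..T}. \<forall>x\<in>X. mesh_within nrm (Xh t) x (\<delta> t)"
    and D2: "\<forall>i\<in>V. \<forall>x\<in>Q 0 i. mesh_within nrm (Xh 0 \<inter> Q 0 i) x (\<delta> 0)"
    and D3: "\<forall>t\<in>{1..T}. \<forall>j\<in>V. \<forall>i\<in>nbrs V E j. \<forall>xh\<in>Xh (t - 1) \<inter> Q (t - 1) j.
               \<forall>x\<in>Theta R Q t i xh. mesh_within nrm (Xh t \<inter> Theta R Q t i xh) x (\<delta> t)"
  shows "\<forall>t\<in>{1..T}. \<forall>i\<in>V. \<forall>xh\<in>Xh (t - 1) \<inter> Q (t - 1) i.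
           (U_val T (nbrs V E) c (Theta R Q) t xh i \<le> Uhat T (nbrs V E) c (Theta R Q) Xh t xh i \<and>
            Uhat T (nbrs V E) c (Theta R Q) Xh t xh i
              \<le> U_val T (nbrs V E) c (Theta R Q) t xh i + Lc * \<delta> T
                  + (\<Sum>\<tau>\<in>{t..<T}. (Lc + Lv T Lc L\<Theta> (\<tau> + 1)) * \<delta> \<tau>)) \<and>
           (\<forall>j\<in>nbrs V E i.
              V_val T (nbrs V E) c (Theta R Q) t xh j \<le> Vhat T (nbrs V E) c (Theta R Q) Xh t xh j \<and>
              Vhat T (nbrs V E) c (Theta R Q) Xh t xh j
                \<le> V_val T (nbrs V E) c (Theta R Q) t xh j + Lc * \<delta> T
                    + (\<Sum>\<tau>\<in>{t..<T}. (Lc + Lv T Lc L\<Theta> (\<tau> + 1)) * \<delta> \<tau>))"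
proof -
  have near: "\<exists>y\<in>Theta R Q (Suc t) j x. nrm (y - y') \<le> L\<Theta> * nrm (x - x')"
    if "t < T" "i \<in> V" "j \<in> nbrs V E i" "x \<in> Q t i" "x' \<in> Q t i" and y': "y' \<in> Theta R Q (Suc t) j x'"
    for t i j x x' y'
  proof -
    have j: "j \<in> V" using that(3) by (simp add: nbrs_def)
    have X: "x \<in> X" "x' \<in> X" using Q_subset[rule_format, of t i] that by auto
    \<comment> \<open>Compactness here and nonemptiness from \<open>A3\<close> below are what
      \<open>dist_H_near_point\<close> requires to extract a point from the bound in
      \<open>A6\<close>.\<close>
    have comp: "compact (Theta R Q (Suc t) j z)" if "z \<in> X" for z
      unfolding Theta_def using A1 A2 that j \<open>t < T\<close> by (intro compact_Int) auto
    have "interior (R x \<inter> Q (Suc t) j) \<noteq> {}"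
      using A3[rule_format, of "Suc t" i j x] that by simp
    then have ne: "Theta R Q (Suc t) j x \<noteq> {}"
      unfolding Theta_def using interior_subset by blast
    \<comment> \<open>The given point lies in the set at \<open>x'\<close>, so this set comes first
      in the distance, and \<open>A6\<close> is applied to \<open>x'\<close> and \<open>x\<close> in
      that order.\<close>
    obtain y where y: "y \<in> Theta R Q (Suc t) j x"
      "nrm (y - y') \<le> dist_H nrm (Theta R Q (Suc t) j x') (Theta R Q (Suc t) j x)"
      using dist_H_near_point[OF norm comp[OF X(2)] comp[OF X(1)] ne y'] .
    note y(2)
    also have "dist_H nrm (Theta R Q (Suc t) j x') (Theta R Q (Suc t) j x) \<le> L\<Theta> * nrm (x' - x)"
      using A6[rule_format, of "Suc t" i j x' x] that by simp
    finally show ?thesis using y(1) is_norm_minus_commute[OF norm, of x x'] by auto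
  qed
  interpret discretized_chasing_game nrm X T V "nbrs V E" Q "Theta R Q" c Lc L\<Theta> \<delta> Xh
  proof
    show "finite (nbrs V E i) \<and> nbrs V E i \<noteq> {} \<and> nbrs V E i \<subseteq> V" if "i \<in> V" for i
      using nbrs_nonempty finite_V that by (auto simp: nbrs_def)
    show "Theta R Q (Suc t) j x \<noteq> {}" if "t < T" "i \<in> V" "j \<in> nbrs V E i" "x \<in> Q t i" for t i j x
      using A3[rule_format, of "Suc t" i j x] that interior_subset by (fastforce simp: Theta_def)
    show "\<exists>yh\<in>Xh (Suc t) \<inter> Theta R Q (Suc t) j x. nrm (yh - y) \<le> \<delta> (Suc t)"
      if "t < T" "i \<in> V" "j \<in> nbrs V E i" "x \<in> Xh t \<inter> Q t i" "y \<in> Theta R Q (Suc t) j x"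
      for t i j x y
    proof -
      have "mesh_within nrm (Xh (Suc t) \<inter> Theta R Q (Suc t) j x) y (\<delta> (Suc t))"
        using D3[rule_format, of "Suc t" i j x y] that by simp
      moreover have "finite (Xh (Suc t) \<inter> Theta R Q (Suc t) j x)" using mesh that(1) by auto
      ultimately show ?thesis by (metis mesh_withinD)
    qed
  qed (use norm Q_subset c_nonneg A5 Lc_nonneg L\<Theta>_nonneg near mesh in \<open>auto simp: Theta_def\<close>)
  show ?thesis
  proof (intro ballI, goal_cases)
    case (1 t i xh)
    then have t: "t \<in> {1..T}" and i: "i \<in> V" and xh: "xh \<in> Xh (t - 1) \<inter> Q (t - 1) i" by auto
    \<comment> \<open>Since \<open>t \<ge> 1\<close>, stage \<open>t\<close> is the successor of
      \<open>t - 1\<close>, which matches the indexing of the locale results.\<close>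
    have s: "t - 1 < T" "Suc (t - 1) = t" "t \<le> T" using t by auto
    show ?case
      using Uhat_bounds[OF s(1) i xh] valh_bounds[OF s(1) i _ xh]
      unfolding s(2) gap_eq_Lv[OF s(3)] by (simp add: add.assoc)
  qed
qed

end
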